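(* Let $0<b<1$. Let $\mathcal{P}^0([-1,1],b)$ be the convex set of all Borel probability measures $\mu$ on $[-1,1]$ that are symmetric with respect to $0$ and satisfy $\int_{-1}^1 x^2\,\mu(\mathrm{d}x)=b^2$. Let $\mathcal{K}(b)$ be the set of all discrete symmetric Borel probability measures on $[-1,1]$ with moments $(m_0,m_1,m_2,m_3)=(1,0,b^2,0)$ and having at most four mass points. Then the set of extreme points of $\mathcal{P}^0([-1,1],b)$ is exactly $\mathcal{K}(b)$: $$\operatorname{ext}\bigl(\mathcal{P}^0([-1,1],b)\bigr)=\mathcal{K}(b).$$
   Context: A Borel measure $\mu$ on $[-1,1]$ is symmetric with respect to $0$ if $\mu(-B)=\mu(B)$ for every Borel set $B\subset[-1,1]$. The moments of $\mu$ are $m_k=\int_{-1}^1 x^k\,\mu(\mathrm{d}x)$. A mass point of $\mu$ is a point $x$ with $\mu(\{x\})>0$; a probability measure is discrete with at most four mass points if it is a convex combination of at most four Dirac measures. A point $x$ of a convex set $D$ is an extreme point of $D$ if $x=tu+(1-t)v$ with $u,v\in D$ and $t\in(0,1)$ implies $u=v=x$; $\operatorname{ext}D$ denotes the set of extreme points of $D$. *)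

theory Defs
  imports "HOL-Probability.Probability"
begin

abbreviation borel_pm1 :: "real measure"
  where "borel_pm1 \<equiv> restrict_space borel {-1..1}"

definition symmetric_measure :: "real measure \<Rightarrow> bool"
  where "symmetric_measure \<mu> \<longleftrightarrow> (\<forall>B\<in>sets \<mu>. emeasure \<mu> (uminus ` B) = emeasure \<mu> B)"

definition moment :: "real measure \<Rightarrow> nat \<Rightarrow> real"
  where "moment \<mu> k = (\<integral>x. x ^ k \<partial>\<mu>)"

text \<open>
  The type of measures is not a real vector space, so neither convex combinations of measures
  nor the extreme points of a set of measures are available from the vector space library.
  Convex combinations are formed setwise.  They are intended for measures on a common
  sigma-algebra; the two lemmas confirm that the construction then has the required values,
  so that the default value of \<^const>\<open>measure_of\<close> does not intervene.
\<close>

definition convex_combination ::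
    "'a measure \<Rightarrow> 'i set \<Rightarrow> ('i \<Rightarrow> real) \<Rightarrow> ('i \<Rightarrow> 'a measure) \<Rightarrow> 'a measure"
  where "convex_combination M I w \<nu> =
    measure_of (space M) (sets M) (\<lambda>B. \<Sum>i\<in>I. ennreal (w i) * emeasure (\<nu> i) B)"

definition mixture :: "real \<Rightarrow> 'a measure \<Rightarrow> 'a measure \<Rightarrow> 'a measure"
  where "mixture t \<mu> \<nu> =
    measure_of (space \<mu>) (sets \<mu>) (\<lambda>B. ennreal t * emeasure \<mu> B + ennreal (1 - t) * emeasure \<nu> B)"

lemma emeasure_convex_combination:
  fixes M :: "'a measure" and \<nu> :: "'i \<Rightarrow> 'a measure"
  assumes "\<And>i. i \<in> I \<Longrightarrow> sets (\<nu> i) = sets M" and "B \<in> sets M"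
  shows "emeasure (convex_combination M I w \<nu>) B = (\<Sum>i\<in>I. ennreal (w i) * emeasure (\<nu> i) B)"
proof (rule emeasure_measure_of[OF convex_combination_def])
  show "sets M \<subseteq> Pow (space M)"
    by (rule sets.space_closed)
  show "B \<in> sets (convex_combination M I w \<nu>)"
    using assms(2) by (simp add: convex_combination_def)
  show "positive (sets (convex_combination M I w \<nu>)) (\<lambda>B. \<Sum>i\<in>I. ennreal (w i) * emeasure (\<nu> i) B)"
    by (simp add: positive_def)
  show "countably_additive (sets (convex_combination M I w \<nu>))
      (\<lambda>B. \<Sum>i\<in>I. ennreal (w i) * emeasure (\<nu> i) B)"
  proof (rule countably_additiveI)
    fix A :: "nat \<Rightarrow> 'a set"
    assume A: "range A \<subseteq> sets (convex_combination M I w \<nu>)" and d: "disjoint_family A"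
    have "(\<Sum>n. \<Sum>i\<in>I. ennreal (w i) * emeasure (\<nu> i) (A n)) =
        (\<Sum>i\<in>I. \<Sum>n. ennreal (w i) * emeasure (\<nu> i) (A n))"
      by (rule suminf_sum) auto
    also have "\<dots> = (\<Sum>i\<in>I. ennreal (w i) * emeasure (\<nu> i) (\<Union>n. A n))"
    proof (rule sum.cong[OF refl])
      fix i assume "i \<in> I"
      then have "range A \<subseteq> sets (\<nu> i)"
        using A assms(1) by (simp add: convex_combination_def)
      then show "(\<Sum>n. ennreal (w i) * emeasure (\<nu> i) (A n)) =
          ennreal (w i) * emeasure (\<nu> i) (\<Union>n. A n)"
        using d by (simp add: suminf_emeasure)
    qed
    finally show "(\<Sum>n. \<Sum>i\<in>I. ennreal (w i) * emeasure (\<nu> i) (A n)) =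
        (\<Sum>i\<in>I. ennreal (w i) * emeasure (\<nu> i) (\<Union>n. A n))" .
  qed
qed

lemma emeasure_mixture:
  assumes "sets \<nu> = sets \<mu>" and "B \<in> sets \<mu>"
  shows "emeasure (mixture t \<mu> \<nu>) B = ennreal t * emeasure \<mu> B + ennreal (1 - t) * emeasure \<nu> B"
proof -
  have "mixture t \<mu> \<nu> = convex_combination \<mu> UNIV (\<lambda>i. if i then t else 1 - t) (\<lambda>i. if i then \<mu> else \<nu>)"
    by (simp add: mixture_def convex_combination_def UNIV_bool add.commute)
  then show ?thesis
    using assms by (simp add: emeasure_convex_combination UNIV_bool add.commute)
qed

definition extreme_measures :: "'a measure set \<Rightarrow> 'a measure set"
  where "extreme_measures D =
    {\<mu> \<in> D. \<forall>u\<in>D. \<forall>v\<in>D. \<forall>t. 0 < t \<and> t < 1 \<and> \<mu> = mixture t u v \<longrightarrow> u = \<mu> \<and> v = \<mu>}"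

definition discrete_at_most :: "nat \<Rightarrow> real measure \<Rightarrow> bool"
  where "discrete_at_most n \<mu> \<longleftrightarrow>
    (\<exists>S w. finite S \<and> card S \<le> n \<and> S \<subseteq> {-1..1} \<and> (\<forall>x\<in>S. 0 \<le> w x) \<and> (\<Sum>x\<in>S. w x) = 1 \<and>
      \<mu> = convex_combination borel_pm1 S w (\<lambda>x. return borel_pm1 x))"

definition sym_prob_measures :: "real \<Rightarrow> real measure set"
  where "sym_prob_measures b =
    {\<mu>. prob_space \<mu> \<and> sets \<mu> = sets borel_pm1 \<and> symmetric_measure \<mu> \<and> moment \<mu> 2 = b\<^sup>2}"

definition sym_discrete_measures :: "real \<Rightarrow> real measure set"
  where "sym_discrete_measures b =
    {\<mu>. prob_space \<mu> \<and> sets \<mu> = sets borel_pm1 \<and> symmetric_measure \<mu> \<and> discrete_at_most 4 \<mu> \<and>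
      moment \<mu> 0 = 1 \<and> moment \<mu> 1 = 0 \<and> moment \<mu> 2 = b\<^sup>2 \<and> moment \<mu> 3 = 0}"

end

theory Submission
  imports Defs
begin

text \<open>
  A symmetric measure is determined by its image under the absolute value, and on that image only
  two linear constraints are imposed, namely the total mass and the second moment.  If \<open>\<mu>\<close> charges
  three disjoint symmetric sets, some nonzero combination \<open>h\<close> of their indicators with
  \<open>\<bar>h\<bar> \<le> 1\<close> is orthogonal to \<open>1\<close> and \<open>x\<^sup>2\<close>, and \<open>\<mu>\<close> is the midpoint of the measures with densities
  \<open>1 + h\<close> and \<open>1 - h\<close>.  Hence the absolute values of the support points of an extreme measure take
  at most two values.  Conversely, on two absolute values the two constraints determine the weights.
\<close>

section \<open>Measures with finite support\<close>

lemma AE_in_full_set: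
  assumes T: "T \<in> sets M" and null: "emeasure M (space M - T) = 0"
  shows "AE x in M. x \<in> T"
proof -
  have "space M - T \<in> null_sets M"
    using null T by (auto intro: null_setsI)
  then have "AE x in M. x \<notin> space M - T"
    by (rule AE_not_in)
  then show ?thesis
    using AE_space by eventually_elim auto
qed

lemma emeasure_finite_support:
  assumes T: "finite T" "\<And>x. x \<in> T \<Longrightarrow> {x} \<in> sets M"
    and null: "emeasure M (space M - T) = 0" and B: "B \<in> sets M"
  shows "emeasure M B = (\<Sum>x\<in>T. emeasure M {x} * indicator B x)"
proof -
  have TM: "T \<in> sets M"
    using sets.finite_UN[OF T(1), of "\<lambda>x. {x}" M] T(2) by simp
  note ae = AE_in_full_set[OF TM null]
  have "emeasure M B = emeasure M (B \<inter> T)"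
    by (rule emeasure_eq_AE) (use ae B TM in auto)
  also have "\<dots> = (\<Sum>x\<in>B \<inter> T. emeasure M {x})"
    using T by (intro emeasure_eq_sum_singleton) auto
  also have "\<dots> = (\<Sum>x\<in>T. emeasure M {x} * indicator B x)"
    using T(1) by (intro sum.mono_neutral_cong_left) (auto simp: indicator_def)
  finally show ?thesis .
qed

lemma (in finite_measure) integral_finite_support:
  fixes g :: "'a \<Rightarrow> real"
  assumes T: "finite T" "\<And>x. x \<in> T \<Longrightarrow> {x} \<in> sets M"
    and null: "emeasure M (space M - T) = 0" and g: "g \<in> borel_measurable M"
  shows "(\<integral>x. g x \<partial>M) = (\<Sum>x\<in>T. g x * measure M {x})"
proof -
  have TM: "T \<in> sets M"
    using sets.finite_UN[OF T(1), of "\<lambda>x. {x}" M] T(2) by simp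
  note ae = AE_in_full_set[OF TM null]
  \<comment> \<open>Off the null set outside \<open>T\<close>, the function \<open>g\<close> is a
    finite combination of indicators of points.\<close>
  have "(\<integral>x. g x \<partial>M) = (\<integral>x. (\<Sum>y\<in>T. g y * indicator {y} x) \<partial>M)"
  proof (rule integral_cong_AE)
    show "AE x in M. g x = (\<Sum>y\<in>T. g y * indicator {y} x)"
      using ae
    proof eventually_elim
      case (elim x)
      have "(\<Sum>y\<in>T. g y * indicator {y} x) = (\<Sum>y\<in>T. if x = y then g y else 0)"
        by (intro sum.cong) auto
      then show ?case using elim T(1) by simp
    qed
    show "(\<lambda>x. \<Sum>y\<in>T. g y * indicator {y} x) \<in> borel_measurable M"
      using T by (intro borel_measurable_sum borel_measurable_times) auto
  qed (fact g)
  also have "\<dots> = (\<Sum>y\<in>T. \<integral>x. g y * indicator {y} x \<partial>M)"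
    using T by (intro Bochner_Integration.integral_sum integrable_mult_right)
      (auto simp: emeasure_eq_measure)
  also have "\<dots> = (\<Sum>x\<in>T. g x * measure M {x})"
    using T by (intro sum.cong) (auto dest: sets.sets_into_space simp: Int_absorb2)
  finally show ?thesis .
qed

section \<open>Symmetric measures on the interval\<close>

lemma sets_borel_pm1D:
  assumes "sets M = sets borel_pm1"
  shows "space M = {-1..1}" and "B \<in> sets M \<longleftrightarrow> B \<in> sets borel \<and> B \<subseteq> {-1..1}"
  using sets_eq_imp_space_eq[OF assms] assms
  by (auto simp: space_restrict_space sets_restrict_space_iff)

lemma borel_measurable_pm1:
  assumes "sets M = sets borel_pm1" and "f \<in> borel_measurable borel"
  shows "f \<in> borel_measurable M"
  by (subst measurable_cong_sets[OF assms(1) refl]) (rule measurable_restrict_space1[OF assms(2)])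

lemma uminus_measurable_pm1:
  assumes "sets M = sets borel_pm1"
  shows "uminus \<in> measurable M M"
proof -
  have "uminus \<in> measurable borel_pm1 borel_pm1"
    by (rule measurable_restrict_space3) auto
  then show ?thesis
    using measurable_cong_sets[OF assms assms] by simp
qed

text \<open>Negation is an involution, so images and preimages agree. This links the image used in
  \<open>symmetric_measure\<close> to the preimage used in \<open>distr\<close>.\<close>

lemma vimage_uminus_pm1:
  assumes sets: "sets M = sets borel_pm1" and B: "B \<in> sets M"
  shows "uminus -` B \<inter> space M = uminus ` B"
proof -
  have "x \<in> uminus ` B" if "- x \<in> B" for x
    using that by (metis image_eqI minus_minus)
  then show ?thesis
    using B sets_borel_pm1D[OF sets] by auto
qed

text \<open>Symmetry is recast as invariance under a push-forward, so that change of variables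
  applies to integrals and densities.\<close>

lemma distr_uminus_symmetric:
  assumes sets: "sets M = sets borel_pm1" and sym: "symmetric_measure M"
  shows "distr M M uminus = M"
proof (rule measure_eqI)
  fix B assume "B \<in> sets (distr M M uminus)"
  then have B: "B \<in> sets M" by simp
  show "emeasure (distr M M uminus) B = emeasure M B"
    using B sym uminus_measurable_pm1[OF sets] vimage_uminus_pm1[OF sets B]
    by (simp add: emeasure_distr symmetric_measure_def)
qed simp

lemma symmetric_measureI_distr:
  assumes sets: "sets M = sets borel_pm1" and distr: "distr M M uminus = M"
  shows "symmetric_measure M"
  unfolding symmetric_measure_def
proof
  fix B assume B: "B \<in> sets M"
  show "emeasure M (uminus ` B) = emeasure M B"
    using emeasure_distr[OF uminus_measurable_pm1[OF sets] B] vimage_uminus_pm1[OF sets B] distr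
    by simp
qed

lemma symmetric_measure_density:
  assumes sets: "sets M = sets borel_pm1" and sym: "symmetric_measure M"
    and f: "f \<in> borel_measurable M" and even: "\<And>x. f (- x) = f x"
  shows "symmetric_measure (density M f)"
proof (rule symmetric_measureI_distr)
  have "density M f = density (distr M M uminus) f"
    by (simp add: distr_uminus_symmetric[OF sets sym])
  also have "\<dots> = distr (density M (\<lambda>x. f (- x))) M uminus"
    by (rule density_distr[OF f uminus_measurable_pm1[OF sets]])
  also have "\<dots> = distr (density M f) (density M f) uminus"
    by (simp add: even cong: distr_cong)
  finally show "distr (density M f) (density M f) uminus = density M f" by simp
qed (simp add: sets)

text \<open>The substitution of \<open>- x\<close> for \<open>x\<close> shows that the integral
  equals its own negative.\<close>

lemma moment_odd_eq_0:
  assumes sets: "sets M = sets borel_pm1" and sym: "symmetric_measure M" and "odd k"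
  shows "moment M k = 0"
proof -
  have "(\<integral>x. x ^ k \<partial>M) = (\<integral>x. x ^ k \<partial>distr M M uminus)"
    by (simp add: distr_uminus_symmetric[OF sets sym])
  also have "\<dots> = (\<integral>x. (- x) ^ k \<partial>M)"
    by (rule integral_distr[OF uminus_measurable_pm1[OF sets] borel_measurable_pm1[OF sets]]) auto
  also have "\<dots> = - (\<integral>x. x ^ k \<partial>M)"
    using \<open>odd k\<close> by simp
  finally show ?thesis by (simp add: moment_def)
qed

section \<open>Extreme measures are discrete\<close>

text \<open>\<open>mixture\<close> takes its space and sigma-algebra from its first measure, hence
  the assumption. Through this lemma a result on the first component of a mixture also covers the
  second.\<close>

lemma mixture_commute:
  assumes "sets u = sets v"
  shows "mixture t u v = mixture (1 - t) v u"
  using assms sets_eq_imp_space_eq[OF assms] by (simp add: mixture_def add.commute)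

text \<open>Each condition on \<open>h\<close> preserves one property: the bound makes
  \<open>1 + h\<close> a nonnegative density, evenness keeps the symmetry, and orthogonality to 1
  and to the square keeps the total mass and the second moment.\<close>

lemma density_perturbation_mem:
  assumes \<mu>: "\<mu> \<in> sym_prob_measures b"
    and h: "h \<in> borel_measurable \<mu>" and bound: "\<And>x. \<bar>h x\<bar> \<le> 1" and even: "\<And>x. h (- x) = h x"
    and h0: "(\<integral>x. h x \<partial>\<mu>) = 0" and h2: "(\<integral>x. h x * x\<^sup>2 \<partial>\<mu>) = 0"
  shows "density \<mu> (\<lambda>x. ennreal (1 + h x)) \<in> sym_prob_measures b"
proof -
  have sets: "sets \<mu> = sets borel_pm1" and sym: "symmetric_measure \<mu>" and m2: "moment \<mu> 2 = b\<^sup>2"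
    and prob: "prob_space \<mu>"
    using \<mu> by (auto simp: sym_prob_measures_def)
  interpret prob_space \<mu> by (fact prob)
  note [measurable] = h
  have [measurable]: "(\<lambda>x. x) \<in> borel_measurable \<mu>"
    by (rule borel_measurable_pm1[OF sets]) simp
  have nonneg: "0 \<le> 1 + h x" for x
    using bound[of x] by linarith
  have sq: "x\<^sup>2 \<le> 1" if "x \<in> space \<mu>" for x
    using that sets_borel_pm1D(1)[OF sets] by (simp add: abs_square_le_1 abs_le_iff)
  have int_h: "integrable \<mu> h"
    by (rule integrable_const_bound[of _ 1]) (use bound in auto)
  have int_sq: "integrable \<mu> (\<lambda>x. x\<^sup>2)"
    by (rule integrable_const_bound[of _ 1]) (use sq in auto)
  have int_hsq: "integrable \<mu> (\<lambda>x. h x * x\<^sup>2)"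
  proof (rule integrable_const_bound[of _ 1])
    have "\<bar>h x\<bar> * x\<^sup>2 \<le> 1" if "x \<in> space \<mu>" for x
      using mult_mono[OF bound[of x] sq[OF that]] by simp
    then show "AE x in \<mu>. norm (h x * x\<^sup>2) \<le> 1"
      by (simp add: abs_mult)
  qed auto
  have "prob_space (density \<mu> (\<lambda>x. ennreal (1 + h x)))"
  proof
    have "emeasure (density \<mu> (\<lambda>x. ennreal (1 + h x))) (space \<mu>) = (\<integral>\<^sup>+x. ennreal (1 + h x) \<partial>\<mu>)"
      by (subst emeasure_density) (auto intro!: nn_integral_cong)
    also have "\<dots> = ennreal (\<integral>x. 1 + h x \<partial>\<mu>)"
      using int_h nonneg by (intro nn_integral_eq_integral) auto
    also have "\<dots> = 1"
      using int_h h0 by (simp add: prob_space)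
    finally show "emeasure (density \<mu> (\<lambda>x. ennreal (1 + h x)))
        (space (density \<mu> (\<lambda>x. ennreal (1 + h x)))) = 1"
      by simp
  qed
  moreover have "symmetric_measure (density \<mu> (\<lambda>x. ennreal (1 + h x)))"
    by (intro symmetric_measure_density sets sym) (auto simp: even)
  moreover have "moment (density \<mu> (\<lambda>x. ennreal (1 + h x))) 2 = b\<^sup>2"
  proof -
    have "moment (density \<mu> (\<lambda>x. ennreal (1 + h x))) 2 = (\<integral>x. (1 + h x) * x\<^sup>2 \<partial>\<mu>)"
      unfolding moment_def by (subst integral_density) (auto simp: nonneg)
    also have "\<dots> = (\<integral>x. x\<^sup>2 + h x * x\<^sup>2 \<partial>\<mu>)"
      by (simp add: algebra_simps)
    also have "\<dots> = b\<^sup>2"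
      using m2 h2 int_sq int_hsq by (simp add: moment_def)
    finally show ?thesis .
  qed
  ultimately show ?thesis
    using sets by (simp add: sym_prob_measures_def)
qed

text \<open>The measures with densities \<open>1 + h\<close> and \<open>1 - h\<close> have
  \<open>\<mu>\<close> as their midpoint. Extremality makes the first of them equal to
  \<open>\<mu>\<close>, and uniqueness of densities then gives \<open>1 + h = 1\<close> almost
  everywhere.\<close>

lemma extreme_perturbation_AE_0:
  assumes \<mu>: "\<mu> \<in> extreme_measures (sym_prob_measures b)"
    and h: "h \<in> borel_measurable \<mu>" and bound: "\<And>x. \<bar>h x\<bar> \<le> 1" and even: "\<And>x. h (- x) = h x"
    and h0: "(\<integral>x. h x \<partial>\<mu>) = 0" and h2: "(\<integral>x. h x * x\<^sup>2 \<partial>\<mu>) = 0"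
  shows "AE x in \<mu>. h x = 0"
proof -
  define u where "u = density \<mu> (\<lambda>x. ennreal (1 + h x))"
  \<comment> \<open>Written with \<open>+ -\<close> so that \<open>density_perturbation_mem\<close>
    applies literally to the function \<open>- h\<close>.\<close>
  define v where "v = density \<mu> (\<lambda>x. ennreal (1 + - h x))"
  have \<mu>D: "\<mu> \<in> sym_prob_measures b"
    using \<mu> by (simp add: extreme_measures_def)
  then interpret prob_space \<mu>
    by (simp add: sym_prob_measures_def)
  note [measurable] = h
  have uD: "u \<in> sym_prob_measures b"
    unfolding u_def by (rule density_perturbation_mem[OF \<mu>D h bound even h0 h2])
  have vD: "v \<in> sym_prob_measures b"
    unfolding v_def by (rule density_perturbation_mem[OF \<mu>D]) (auto simp: bound even h0 h2)
  have "\<mu> = mixture (1/2) u v"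
  proof (rule measure_eqI)
    show "sets \<mu> = sets (mixture (1/2) u v)"
      by (simp add: mixture_def u_def sets.sigma_sets_eq sets.space_closed)
    fix B assume B [measurable]: "B \<in> sets \<mu>"
    have half: "ennreal (1/2) * (ennreal (1 + h x) * indicator B x) +
        ennreal (1/2) * (ennreal (1 + - h x) * indicator B x) = indicator B x" for x
    proof -
      have "ennreal (1/2) * ennreal (1 + h x) + ennreal (1/2) * ennreal (1 + - h x) =
          ennreal (1/2 * (1 + h x)) + ennreal (1/2 * (1 + - h x))"
        by (simp only: ennreal_mult')
      also have "\<dots> = ennreal (1/2 * (1 + h x) + 1/2 * (1 + - h x))"
        using bound[of x] by (intro ennreal_plus[symmetric]) auto
      also have "\<dots> = 1"
        by (simp add: field_simps)
      finally have "ennreal (1/2) * ennreal (1 + h x) + ennreal (1/2) * ennreal (1 + - h x) = 1" .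
      then show ?thesis by (simp split: split_indicator)
    qed
    have "emeasure (mixture (1/2) u v) B = ennreal (1/2) * emeasure u B + ennreal (1/2) * emeasure v B"
      by (subst emeasure_mixture) (auto simp: u_def v_def)
    also have "\<dots> = (\<integral>\<^sup>+x. ennreal (1/2) * (ennreal (1 + h x) * indicator B x) +
        ennreal (1/2) * (ennreal (1 + - h x) * indicator B x) \<partial>\<mu>)"
      unfolding u_def v_def
      by (subst nn_integral_add) (auto simp: emeasure_density nn_integral_cmult)
    also have "\<dots> = emeasure \<mu> B"
      by (simp only: half nn_integral_indicator[OF B])
    finally show "emeasure \<mu> B = emeasure (mixture (1/2) u v) B" by simp
  qed
  then have "u = \<mu>"
    using \<mu> uD vD unfolding extreme_measures_def
    by (auto dest!: bspec[of _ _ u] bspec[of _ _ v] spec[of _ "1/2"])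
  then have "density \<mu> (\<lambda>x. ennreal (1 + h x)) = density \<mu> (\<lambda>x. 1)"
    by (simp add: u_def density_1)
  then have "AE x in \<mu>. ennreal (1 + h x) = 1"
    by (subst (asm) density_unique_iff) auto
  then show ?thesis
  proof eventually_elim
    case (elim x)
    then show ?case
      using bound[of x] by (simp add: ennreal_eq_1)
  qed
qed

text \<open>A homogeneous system with more unknowns than equations has a nonzero solution.
  Normalizing the sum of absolute values to 1 bounds the resulting combination of indicators by 1
  and records that it is nontrivial.\<close>

lemma three_unknowns_two_equations:
  fixes p1 p2 p3 q1 q2 q3 :: real
  assumes "p1 > 0"
  obtains c1 c2 c3 where "c1 * p1 + c2 * p2 + c3 * p3 = 0" "c1 * q1 + c2 * q2 + c3 * q3 = 0"
    "\<bar>c1\<bar> + \<bar>c2\<bar> + \<bar>c3\<bar> = 1"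
proof -
  obtain d1 d2 d3 where d: "d1 * p1 + d2 * p2 + d3 * p3 = 0" "d1 * q1 + d2 * q2 + d3 * q3 = 0"
    "d1 \<noteq> 0 \<or> d2 \<noteq> 0 \<or> d3 \<noteq> 0"
  proof (cases "p1 * q2 = p2 * q1")
    case True
    \<comment> \<open>The first two columns are proportional, so the third unknown can be 0;
      \<open>p1 > 0\<close> makes this solution nonzero.\<close>
    show ?thesis
      by (rule that[of p2 "- p1" 0]) (use assms True in \<open>auto simp: algebra_simps\<close>)
  next
    case False
    \<comment> \<open>The cross product of the two coefficient vectors is orthogonal to both; its
      third component is nonzero in this case.\<close>
    show ?thesis
      by (rule that[of "p2 * q3 - p3 * q2" "p3 * q1 - p1 * q3" "p1 * q2 - p2 * q1"])
        (use False in \<open>auto simp: algebra_simps\<close>)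
  qed
  define s where "s = \<bar>d1\<bar> + \<bar>d2\<bar> + \<bar>d3\<bar>"
  have "s > 0"
    using d(3) by (auto simp: s_def)
  show ?thesis
  proof (rule that[of "d1 / s" "d2 / s" "d3 / s"])
    show "d1 / s * p1 + d2 / s * p2 + d3 / s * p3 = 0"
      using d(1) by (simp add: add_divide_distrib[symmetric])
    show "d1 / s * q1 + d2 / s * q2 + d3 / s * q3 = 0"
      using d(2) by (simp add: add_divide_distrib[symmetric])
    show "\<bar>d1 / s\<bar> + \<bar>d2 / s\<bar> + \<bar>d3 / s\<bar> = 1"
      using \<open>s > 0\<close> by (simp add: add_divide_distrib[symmetric]) (simp add: s_def)
  qed
qed

text \<open>A normalized combination \<open>h\<close> of the three indicators, orthogonal to 1 and
  to the square, must vanish almost everywhere. By disjointness \<open>h\<close> is constant on each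
  set, equal to the coefficient there, and each set has positive measure, so all coefficients would
  be 0.\<close>

lemma extreme_no_three_sets:
  assumes \<mu>: "\<mu> \<in> extreme_measures (sym_prob_measures b)"
    and meas: "A1 \<in> sets \<mu>" "A2 \<in> sets \<mu>" "A3 \<in> sets \<mu>"
    and pos: "emeasure \<mu> A1 > 0" "emeasure \<mu> A2 > 0" "emeasure \<mu> A3 > 0"
    and disj: "A1 \<inter> A2 = {}" "A1 \<inter> A3 = {}" "A2 \<inter> A3 = {}"
    and sym: "\<And>x. - x \<in> A1 \<longleftrightarrow> x \<in> A1" "\<And>x. - x \<in> A2 \<longleftrightarrow> x \<in> A2" "\<And>x. - x \<in> A3 \<longleftrightarrow> x \<in> A3"
  shows False
proof -
  have sets: "sets \<mu> = sets borel_pm1" and "prob_space \<mu>"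
    using \<mu> by (auto simp: extreme_measures_def sym_prob_measures_def)
  interpret prob_space \<mu> by fact
  have [measurable]: "(\<lambda>x. x) \<in> borel_measurable \<mu>"
    by (rule borel_measurable_pm1[OF sets]) simp
  note [measurable] = meas
  \<comment> \<open>The coefficients of the two equations are the masses of the three sets and their
    contributions \<open>q\<close> to the second moment.\<close>
  define q where "q A = (\<integral>x. indicator A x * x\<^sup>2 \<partial>\<mu>)" for A :: "real set"
  have int_ind: "integrable \<mu> (\<lambda>x. indicator A x :: real)" if "A \<in> sets \<mu>" for A
    using that by (simp add: emeasure_eq_measure)
  have int_q: "integrable \<mu> (\<lambda>x. indicator A x * x\<^sup>2)" if [measurable]: "A \<in> sets \<mu>" for A
    by (rule integrable_const_bound[of _ 1])
      (use sets_borel_pm1D(1)[OF sets] in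
        \<open>auto simp: abs_square_le_1 abs_le_iff split: split_indicator\<close>)
  have "measure \<mu> A1 > 0"
    using pos(1) by (simp add: emeasure_eq_measure)
  then obtain c1 c2 c3 where
    c0: "c1 * measure \<mu> A1 + c2 * measure \<mu> A2 + c3 * measure \<mu> A3 = 0" and
    c2: "c1 * q A1 + c2 * q A2 + c3 * q A3 = 0" and cs: "\<bar>c1\<bar> + \<bar>c2\<bar> + \<bar>c3\<bar> = 1"
    by (rule three_unknowns_two_equations)
  define h where "h x = c1 * indicator A1 x + c2 * indicator A2 x + c3 * indicator A3 x" for x
  have "AE x in \<mu>. h x = 0"
  proof (rule extreme_perturbation_AE_0[OF \<mu>])
    show "h \<in> borel_measurable \<mu>"
      unfolding h_def by measurable
    show "\<bar>h x\<bar> \<le> 1" for x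
      using cs by (auto simp: h_def indicator_def)
    show "h (- x) = h x" for x
      using sym by (simp add: h_def indicator_def)
    show "(\<integral>x. h x \<partial>\<mu>) = 0"
      using c0 meas unfolding h_def
      by (simp add: int_ind Int_absorb2 sets.sets_into_space)
    have "(\<integral>x. h x * x\<^sup>2 \<partial>\<mu>) = (\<integral>x. c1 * (indicator A1 x * x\<^sup>2) + c2 * (indicator A2 x * x\<^sup>2) +
        c3 * (indicator A3 x * x\<^sup>2) \<partial>\<mu>)"
      by (simp add: h_def algebra_simps)
    also have "\<dots> = 0"
      using c2 meas by (simp add: int_q q_def)
    finally show "(\<integral>x. h x * x\<^sup>2 \<partial>\<mu>) = 0" .
  qed
  have ex: "\<exists>x\<in>A. h x = 0" if "A \<in> sets \<mu>" "emeasure \<mu> A > 0" for A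
  proof (rule ccontr)
    assume "\<not> (\<exists>x\<in>A. h x = 0)"
    then have "AE x in \<mu>. x \<notin> A"
      using \<open>AE x in \<mu>. h x = 0\<close> by (auto elim: eventually_mono)
    then have "A \<in> null_sets \<mu>"
      using that by (simp add: AE_iff_null_sets)
    with that show False by auto
  qed
  have "c1 = 0"
  proof -
    obtain x where "x \<in> A1" "h x = 0" using ex[OF meas(1) pos(1)] by blast
    moreover have "x \<notin> A2" "x \<notin> A3" using \<open>x \<in> A1\<close> disj by auto
    ultimately show ?thesis by (simp add: h_def)
  qed
  moreover have "c2 = 0"
  proof -
    obtain x where "x \<in> A2" "h x = 0" using ex[OF meas(2) pos(2)] by blast
    moreover have "x \<notin> A1" "x \<notin> A3" using \<open>x \<in> A2\<close> disj by auto
    ultimately show ?thesis by (simp add: h_def)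
  qed
  moreover have "c3 = 0"
  proof -
    obtain x where "x \<in> A3" "h x = 0" using ex[OF meas(3) pos(3)] by blast
    moreover have "x \<notin> A1" "x \<notin> A2" using \<open>x \<in> A3\<close> disj by auto
    ultimately show ?thesis by (simp add: h_def)
  qed
  ultimately show False
    using cs by simp
qed

section \<open>The closed support of the image of \<open>\<mu>\<close> under the absolute
  value\<close>

definition abs_support :: "real measure \<Rightarrow> real set"
  where "abs_support \<mu> = {a \<in> {0..1}.
    \<forall>p q. p < a \<and> a < q \<longrightarrow> emeasure \<mu> {x \<in> {-1..1}. \<bar>x\<bar> \<in> {p<..<q}} > 0}"

lemma abs_preimage_sets:
  assumes "sets M = sets borel_pm1"
  shows "{x \<in> {-1..1}. \<bar>x\<bar> \<in> {p<..<q}} \<in> sets M"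
proof -
  have "{x \<in> {-1..1}. \<bar>x\<bar> \<in> {p<..<q}} = {-1..1} \<inter> (abs -` {p<..<q} \<inter> space (borel :: real measure))"
    by auto
  also have "\<dots> \<in> sets borel"
    by (intro sets.Int measurable_sets[OF borel_measurable_abs]) auto
  finally show ?thesis
    using sets_borel_pm1D(2)[OF assms] by auto
qed

text \<open>An absolute value outside the support lies in an open interval with null preimage. The
  interval can be shrunk to one with rational endpoints, and countably many null sets have a null
  union.\<close>

lemma AE_abs_support:
  assumes sets: "sets \<mu> = sets borel_pm1"
  shows "AE x in \<mu>. \<bar>x\<bar> \<in> abs_support \<mu>"
proof -
  define E where "E p q = {x \<in> {-1..1::real}. \<bar>x\<bar> \<in> {p<..<q}}" for p q
  define I where "I = {(p, q). p \<in> \<rat> \<and> q \<in> \<rat> \<and> emeasure \<mu> (E p q) = 0}"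
  have "I \<subseteq> \<rat> \<times> \<rat>" by (auto simp: I_def)
  then have "countable I"
    by (rule countable_subset) (intro countable_SIGMA countable_rat)
  then have null: "(\<Union>(p, q)\<in>I. E p q) \<in> null_sets \<mu>"
    using abs_preimage_sets[OF sets] by (intro null_sets_UN') (auto simp: I_def E_def)
  show ?thesis
  proof (rule AE_I'[OF null], rule subsetI)
    fix x assume "x \<in> {x \<in> space \<mu>. \<bar>x\<bar> \<notin> abs_support \<mu>}"
    then have x: "x \<in> {-1..1}" and "\<bar>x\<bar> \<notin> abs_support \<mu>"
      using sets_borel_pm1D(1)[OF sets] by auto
    then obtain p q where pq: "p < \<bar>x\<bar>" "\<bar>x\<bar> < q" "emeasure \<mu> (E p q) = 0"
      by (force simp: abs_support_def E_def)
    obtain p' q' where "p' \<in> \<rat>" "q' \<in> \<rat>" and pq': "p < p'" "p' < \<bar>x\<bar>" "\<bar>x\<bar> < q'" "q' < q"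
      using Rats_dense_in_real[OF pq(1)] Rats_dense_in_real[OF pq(2)] by auto
    have "emeasure \<mu> (E p' q') \<le> emeasure \<mu> (E p q)"
      using pq' abs_preimage_sets[OF sets] by (intro emeasure_mono) (auto simp: E_def)
    then have "(p', q') \<in> I"
      using \<open>p' \<in> \<rat>\<close> \<open>q' \<in> \<rat>\<close> pq(3) by (simp add: I_def)
    then show "x \<in> (\<Union>(p, q)\<in>I. E p q)"
      using x pq' by (force simp: E_def)
  qed
qed

text \<open>Three distinct support points would have disjoint neighbourhoods, whose preimages under
  the absolute value are symmetric sets of positive measure, against
  \<open>extreme_no_three_sets\<close>.\<close>

lemma extreme_abs_support_card:
  assumes \<mu>: "\<mu> \<in> extreme_measures (sym_prob_measures b)"
  shows "finite (abs_support \<mu>) \<and> card (abs_support \<mu>) \<le> 2"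
proof (rule ccontr)
  assume "\<not> ?thesis"
  then have "infinite (abs_support \<mu>) \<or> 3 \<le> card (abs_support \<mu>)" by auto
  then obtain Z where "Z \<subseteq> abs_support \<mu>" "card Z = 3"
    by (metis infinite_arbitrarily_large obtain_subset_with_card_n)
  then obtain x y z where xyz: "x \<in> abs_support \<mu>" "y \<in> abs_support \<mu>" "z \<in> abs_support \<mu>"
    "x \<noteq> y" "x \<noteq> z" "y \<noteq> z"
    by (auto simp: card_3_iff)
  \<comment> \<open>Half the least distance, so that the open intervals of radius \<open>e\<close>
    are pairwise disjoint.\<close>
  define e where "e = min (\<bar>x - y\<bar>) (min (\<bar>x - z\<bar>) (\<bar>y - z\<bar>)) / 2"
  have e: "e > 0" "2 * e \<le> \<bar>x - y\<bar>" "2 * e \<le> \<bar>x - z\<bar>" "2 * e \<le> \<bar>y - z\<bar>"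
    using xyz by (auto simp: e_def)
  define E where "E a = {w \<in> {-1..1::real}. \<bar>w\<bar> \<in> {a - e<..<a + e}}" for a
  have sets: "sets \<mu> = sets borel_pm1"
    using \<mu> by (auto simp: extreme_measures_def sym_prob_measures_def)
  have meas: "E a \<in> sets \<mu>" for a
    unfolding E_def by (rule abs_preimage_sets[OF sets])
  have pos: "emeasure \<mu> (E a) > 0" if "a \<in> abs_support \<mu>" for a
    using that e(1) by (auto simp: abs_support_def E_def)
  have sym: "- w \<in> E a \<longleftrightarrow> w \<in> E a" for w a
    by (auto simp: E_def)
  have disj: "E a \<inter> E a' = {}" if "2 * e \<le> \<bar>a - a'\<bar>" for a a'
    using that by (auto simp: E_def)
  show False
    by (rule extreme_no_three_sets[of \<mu> b "E x" "E y" "E z"])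
      (simp_all add: \<mu> meas pos disj sym xyz e)
qed

section \<open>From finite support to a convex combination of Dirac measures\<close>

lemma sets_convex_combination: "sets (convex_combination M I w \<nu>) = sets M"
  by (simp add: convex_combination_def sets.sigma_sets_eq sets.space_closed)

text \<open>This serves both directions: it supplies the form demanded by
  \<open>discrete_at_most\<close>, and it reduces equality of two measures supported in
  \<open>T\<close> to equality of their point masses.\<close>

lemma convex_combination_return_finite_support:
  assumes sets: "sets \<mu> = sets borel_pm1" and "finite_measure \<mu>"
    and T: "finite T" "T \<subseteq> {-1..1}" and null: "emeasure \<mu> (space \<mu> - T) = 0"
  shows "\<mu> = convex_combination borel_pm1 T (\<lambda>x. measure \<mu> {x}) (\<lambda>x. return borel_pm1 x)"
    (is "\<mu> = ?C")
proof (rule measure_eqI)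
  interpret finite_measure \<mu> by fact
  show "sets \<mu> = sets ?C"
    by (simp add: sets_convex_combination sets)
  fix B assume B: "B \<in> sets \<mu>"
  have "{x} \<in> sets \<mu>" if "x \<in> T" for x
    using T that sets_borel_pm1D(2)[OF sets] by auto
  then have "emeasure \<mu> B = (\<Sum>x\<in>T. emeasure \<mu> {x} * indicator B x)"
    using emeasure_finite_support[OF T(1) _ null B] by simp
  also have "\<dots> = emeasure ?C B"
    using B sets by (subst emeasure_convex_combination) (auto simp: emeasure_eq_measure)
  finally show "emeasure \<mu> B = emeasure ?C B" .
qed

lemma extreme_imp_discrete:
  assumes \<mu>: "\<mu> \<in> extreme_measures (sym_prob_measures b)"
  shows "\<mu> \<in> sym_discrete_measures b"
proof -
  have sets: "sets \<mu> = sets borel_pm1" and sym: "symmetric_measure \<mu>" and m2: "moment \<mu> 2 = b\<^sup>2"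
    and prob: "prob_space \<mu>"
    using \<mu> by (auto simp: extreme_measures_def sym_prob_measures_def)
  interpret prob_space \<mu> by (fact prob)
  \<comment> \<open>At most two absolute values, each with two signs, give the bound of four mass
    points.\<close>
  define T where "T = abs_support \<mu> \<union> uminus ` abs_support \<mu>"
  have fin: "finite (abs_support \<mu>)" and card: "card (abs_support \<mu>) \<le> 2"
    using extreme_abs_support_card[OF \<mu>] by auto
  have "finite T"
    using fin by (simp add: T_def)
  have "card T \<le> 4"
    using card card_Un_le[of "abs_support \<mu>" "uminus ` abs_support \<mu>"]
      card_image_le[OF fin, of uminus]
    unfolding T_def by linarith
  have T1: "T \<subseteq> {-1..1}"
    by (auto simp: T_def abs_support_def)
  have TM: "T \<in> sets \<mu>"
    using T1 \<open>finite T\<close> sets_borel_pm1D(2)[OF sets] by (simp add: borel_closed finite_imp_closed)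
  have "AE x in \<mu>. x \<in> T"
    using AE_abs_support[OF sets]
  proof eventually_elim
    case (elim x)
    have "x = \<bar>x\<bar> \<or> x = - \<bar>x\<bar>" by linarith
    then show ?case
      using elim unfolding T_def by (metis UnCI image_eqI)
  qed
  then have prob_T: "prob T = 1"
    using TM by (simp add: prob_eq_1)
  then have null: "emeasure \<mu> (space \<mu> - T) = 0"
    using TM by (simp add: emeasure_eq_measure prob_compl)
  have single: "{x} \<in> sets \<mu>" if "x \<in> T" for x
    using that T1 sets_borel_pm1D(2)[OF sets] by auto
  have "(\<Sum>x\<in>T. measure \<mu> {x}) = 1"
    using finite_measure_eq_sum_singleton[OF \<open>finite T\<close> single] prob_T by simp
  then have "discrete_at_most 4 \<mu>"
    unfolding discrete_at_most_def
    using convex_combination_return_finite_support[OF sets _ \<open>finite T\<close> T1 null]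
      \<open>finite T\<close> \<open>card T \<le> 4\<close> T1 finite_measure_axioms
    by (intro exI[of _ T] exI[of _ "\<lambda>x. measure \<mu> {x}"]) auto
  moreover have "moment \<mu> 0 = 1"
    by (simp add: moment_def prob_space)
  ultimately show ?thesis
    using sets sym m2 prob by (simp add: sym_discrete_measures_def moment_odd_eq_0)
qed

section \<open>Discrete measures are extreme\<close>

text \<open>Of three points with distinct squares at most one is 0. The other two bring their
  negatives along, which makes five points in \<open>T\<close>.\<close>

lemma symmetric_card_le_4_two_squares:
  fixes T :: "real set"
  assumes T: "finite T" "card T \<le> 4" and sym: "\<And>x. x \<in> T \<Longrightarrow> - x \<in> T" and x0: "x0 \<in> T"
  shows "\<exists>y. y\<^sup>2 \<noteq> x0\<^sup>2 \<and> (\<forall>x\<in>T. x\<^sup>2 = x0\<^sup>2 \<or> x\<^sup>2 = y\<^sup>2)"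
proof (cases "\<exists>y\<in>T. y\<^sup>2 \<noteq> x0\<^sup>2")
  case True
  then obtain y where y: "y \<in> T" "y\<^sup>2 \<noteq> x0\<^sup>2" by blast
  show ?thesis
  proof (intro exI[of _ y] conjI ballI, fact y(2), rule ccontr)
    fix z assume z: "z \<in> T" and "\<not> (z\<^sup>2 = x0\<^sup>2 \<or> z\<^sup>2 = y\<^sup>2)"
    then have ne: "z\<^sup>2 \<noteq> x0\<^sup>2" "z\<^sup>2 \<noteq> y\<^sup>2" by auto
    \<comment> \<open>Only \<open>d\<close> may be 0, so it is counted without its negative. The
      case distinction below puts a vanishing point, if there is one, in this position.\<close>
    have no_five: False
      if "a \<in> T" "c \<in> T" "d \<in> T" "a\<^sup>2 \<noteq> c\<^sup>2" "a\<^sup>2 \<noteq> d\<^sup>2" "c\<^sup>2 \<noteq> d\<^sup>2" "a \<noteq> 0" "c \<noteq> 0" for a c d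
    proof -
      have "card {a, - a, c, - c, d} = 5"
        using that by (auto simp: power2_eq_iff)
      moreover have "{a, - a, c, - c, d} \<subseteq> T"
        using that sym by auto
      ultimately show False
        using card_mono[OF T(1), of "{a, - a, c, - c, d}"] T(2) by linarith
    qed
    show False
    proof (cases "x0 = 0")
      case True
      then show False
        using no_five[of y z x0] x0 y z ne by auto
    next
      case False
      note x0_ne = this
      show False
      proof (cases "y = 0")
        case True
        then show False
          using no_five[of x0 z y] x0 x0_ne y z ne by auto
      next
        case False
        then show False
          using no_five[of x0 y z] x0 x0_ne y z ne by auto
      qed
    qed
  qed
next
  case False
  \<comment> \<open>Here a single square occurs in \<open>T\<close>, so any \<open>y\<close> with a
    different square will do.\<close>
  have "(\<bar>x0\<bar> + 1)\<^sup>2 \<noteq> x0\<^sup>2"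
    by (auto simp: power2_eq_iff)
  then show ?thesis
    using False by blast
qed

text \<open>The two equations combine to a sum of \<open>f\<close> against
  \<open>x\<^sup>2 - y\<^sup>2\<close>, where \<open>y\<^sup>2\<close> is the other square that may
  occur in \<open>T\<close>. Only the points \<open>x0\<close> and \<open>- x0\<close> survive, and
  evenness turns the sum into a nonzero multiple of \<open>f x0\<close>.\<close>

lemma even_weights_determined:
  fixes f :: "real \<Rightarrow> real"
  assumes T: "finite T" "card T \<le> 4" and sym: "\<And>x. x \<in> T \<Longrightarrow> - x \<in> T"
    and even: "\<And>x. x \<in> T \<Longrightarrow> f (- x) = f x"
    and f0: "(\<Sum>x\<in>T. f x) = 0" and f2: "(\<Sum>x\<in>T. x\<^sup>2 * f x) = 0" and x0: "x0 \<in> T"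
  shows "f x0 = 0"
proof -
  obtain y where y: "y\<^sup>2 \<noteq> x0\<^sup>2" "\<And>x. x \<in> T \<Longrightarrow> x\<^sup>2 = x0\<^sup>2 \<or> x\<^sup>2 = y\<^sup>2"
    using symmetric_card_le_4_two_squares[OF T _ x0] sym by blast
  have "0 = (\<Sum>x\<in>T. x\<^sup>2 * f x) - y\<^sup>2 * (\<Sum>x\<in>T. f x)"
    using f0 f2 by simp
  also have "\<dots> = (\<Sum>x\<in>T. (x\<^sup>2 - y\<^sup>2) * f x)"
    by (simp add: sum_distrib_left sum_subtractf[symmetric] left_diff_distrib)
  also have "\<dots> = (\<Sum>x\<in>T. if x\<^sup>2 = x0\<^sup>2 then (x0\<^sup>2 - y\<^sup>2) * f x0 else 0)"
  proof (rule sum.cong[OF refl])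
    fix x assume x: "x \<in> T"
    have "f x = f x0" if "x\<^sup>2 = x0\<^sup>2"
      using that even[OF x0] by (auto simp: power2_eq_iff)
    then show "(x\<^sup>2 - y\<^sup>2) * f x = (if x\<^sup>2 = x0\<^sup>2 then (x0\<^sup>2 - y\<^sup>2) * f x0 else 0)"
      using y(2)[OF x] by auto
  qed
  also have "\<dots> = real (card {x \<in> T. x\<^sup>2 = x0\<^sup>2}) * ((x0\<^sup>2 - y\<^sup>2) * f x0)"
    using T(1) by (simp add: sum.inter_filter[symmetric])
  finally show ?thesis
    using y(1) x0 T(1) by (auto simp: card_eq_0_iff)
qed

text \<open>The difference of the point masses of \<open>u\<close> and \<open>\<mu>\<close> is even
  on \<open>T\<close> and has zero sum and zero second moment, so
  \<open>even_weights_determined\<close> makes it vanish.\<close>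

lemma finite_support_measure_determined:
  assumes u: "u \<in> sym_prob_measures b" and \<mu>: "\<mu> \<in> sym_prob_measures b"
    and T: "finite T" "card T \<le> 4" "T \<subseteq> {-1..1}" and symT: "\<And>x. x \<in> T \<Longrightarrow> - x \<in> T"
    and null: "emeasure u (space u - T) = 0" "emeasure \<mu> (space \<mu> - T) = 0"
  shows "u = \<mu>"
proof -
  have weights: "(\<Sum>x\<in>T. measure \<nu> {x}) = 1 \<and> (\<Sum>x\<in>T. x\<^sup>2 * measure \<nu> {x}) = b\<^sup>2 \<and>
      (\<forall>x\<in>T. measure \<nu> {- x} = measure \<nu> {x}) \<and>
      \<nu> = convex_combination borel_pm1 T (\<lambda>x. measure \<nu> {x}) (\<lambda>x. return borel_pm1 x)"
    if \<nu>: "\<nu> \<in> sym_prob_measures b" and null: "emeasure \<nu> (space \<nu> - T) = 0" for \<nu>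
  proof -
    have sets: "sets \<nu> = sets borel_pm1" and sym: "symmetric_measure \<nu>"
      and m2: "moment \<nu> 2 = b\<^sup>2" and "prob_space \<nu>"
      using \<nu> by (auto simp: sym_prob_measures_def)
    interpret prob_space \<nu> by fact
    have single: "{x} \<in> sets \<nu>" if "x \<in> T" for x
      using that T(3) sets_borel_pm1D(2)[OF sets] by auto
    have "(\<Sum>x\<in>T. measure \<nu> {x}) = 1"
      using integral_finite_support[OF T(1) single null, of "\<lambda>x. 1"] by (simp add: prob_space)
    moreover have "(\<lambda>x. x\<^sup>2) \<in> borel_measurable \<nu>"
      by (rule borel_measurable_pm1[OF sets]) simp
    then have "(\<Sum>x\<in>T. x\<^sup>2 * measure \<nu> {x}) = b\<^sup>2"
      using integral_finite_support[OF T(1) single null, of "\<lambda>x. x\<^sup>2"] m2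
      by (simp add: moment_def)
    moreover have "measure \<nu> {- x} = measure \<nu> {x}" if "x \<in> T" for x
    proof -
      have "emeasure \<nu> (uminus ` {x}) = emeasure \<nu> {x}"
        using sym single[OF that] unfolding symmetric_measure_def by blast
      then show ?thesis by (simp add: measure_def)
    qed
    moreover have "\<nu> = convex_combination borel_pm1 T (\<lambda>x. measure \<nu> {x}) (\<lambda>x. return borel_pm1 x)"
      by (rule convex_combination_return_finite_support[OF sets finite_measure_axioms T(1,3) null])
    ultimately show ?thesis by blast
  qed
  note wu = weights[OF u null(1)] and w\<mu> = weights[OF \<mu> null(2)]
  have eq: "measure u {x} = measure \<mu> {x}" if "x \<in> T" for x
  proof -
    have "measure u {x} - measure \<mu> {x} = 0"
    proof (rule even_weights_determined[OF T(1,2) symT, of "\<lambda>x. measure u {x} - measure \<mu> {x}"])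
      show "(\<Sum>x\<in>T. x\<^sup>2 * (measure u {x} - measure \<mu> {x})) = 0"
        using wu w\<mu> by (simp add: right_diff_distrib sum_subtractf)
    qed (use wu w\<mu> that in \<open>auto simp: sum_subtractf\<close>)
    then show ?thesis by simp
  qed
  have "u = convex_combination borel_pm1 T (\<lambda>x. measure u {x}) (\<lambda>x. return borel_pm1 x)"
    using wu by blast
  also have "\<dots> = convex_combination borel_pm1 T (\<lambda>x. measure \<mu> {x}) (\<lambda>x. return borel_pm1 x)"
    unfolding convex_combination_def using eq by (simp cong: sum.cong)
  also have "\<dots> = \<mu>"
    using w\<mu> by simp
  finally show ?thesis .
qed

lemma discrete_symmetric_support:
  assumes sets: "sets \<mu> = sets borel_pm1" and sym: "symmetric_measure \<mu>"
    and disc: "discrete_at_most n \<mu>"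
  obtains T where "finite T" "card T \<le> n" "T \<subseteq> {-1..1}" "\<And>x. x \<in> T \<Longrightarrow> - x \<in> T"
    "emeasure \<mu> (space \<mu> - T) = 0"
proof -
  obtain S w where S: "finite S" "card S \<le> n" "S \<subseteq> {-1..1}"
    and \<mu>: "\<mu> = convex_combination borel_pm1 S w (\<lambda>x. return borel_pm1 x)"
    using disc unfolding discrete_at_most_def by blast
  \<comment> \<open>\<open>S\<close> itself may fail to be symmetric, since it may contain points of
    weight 0. The set of actual mass points inherits the symmetry of \<open>\<mu>\<close>.\<close>
  define T where "T = {x \<in> S. emeasure \<mu> {x} \<noteq> 0}"
  have em: "emeasure \<mu> B = (\<Sum>x\<in>S. ennreal (w x) * indicator B x)" if "B \<in> sets \<mu>" for B
    using that sets by (subst \<mu>, subst emeasure_convex_combination) auto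
  have single: "{x} \<in> sets \<mu>" if "x \<in> {-1..1}" for x
    using that sets_borel_pm1D(2)[OF sets] by auto
  have TM: "T \<in> sets \<mu>"
    using S sets_borel_pm1D(2)[OF sets]
    by (auto simp: T_def intro!: borel_closed finite_imp_closed)
  have symT: "- x \<in> T" if x: "x \<in> T" for x
  proof -
    have x1: "{x} \<in> sets \<mu>" "{- x} \<in> sets \<mu>"
      using x S(3) by (auto simp: T_def intro!: single)
    have "emeasure \<mu> (uminus ` {x}) = emeasure \<mu> {x}"
      using sym x1(1) unfolding symmetric_measure_def by blast
    then have ne: "emeasure \<mu> {- x} \<noteq> 0"
      using x by (simp add: T_def)
    \<comment> \<open>A singleton disjoint from \<open>S\<close> has measure 0 by the formula
      \<open>em\<close>.\<close>
    then have "- x \<in> S"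
      using em[OF x1(2)] by (metis (mono_tags, lifting) indicator_simps(2) mult_zero_right singletonD sum.neutral)
    then show ?thesis
      using ne by (simp add: T_def)
  qed
  have "ennreal (w x) * indicator (space \<mu> - T) x = 0" if "x \<in> S" for x
  proof (cases "x \<in> T")
    case False
    then have "emeasure \<mu> {x} = 0"
      using that by (simp add: T_def)
    then have "ennreal (w x) * indicator {x} x = 0"
      using em[OF single] S that by (subst (asm) em[OF single]) auto
    then show ?thesis by simp
  qed simp
  then have "(\<Sum>x\<in>S. ennreal (w x) * indicator (space \<mu> - T) x) = 0"
    by (intro sum.neutral) blast
  then have "emeasure \<mu> (space \<mu> - T) = 0"
    using em[of "space \<mu> - T"] TM by simp
  moreover have "card T \<le> n"
    using card_mono[OF S(1), of T] S(2) by (auto simp: T_def)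
  ultimately show ?thesis
    using S symT by (intro that[of T]) (auto simp: T_def)
qed

text \<open>Since \<open>t > 0\<close>, every null set of the mixture is null for \<open>u\<close>.
  Hence \<open>u\<close> lives on the same symmetric set of at most four points as
  \<open>\<mu>\<close>, where the constraints leave only one measure.\<close>

lemma mixture_component_eq:
  assumes \<mu>: "\<mu> \<in> sym_discrete_measures b" and u: "u \<in> sym_prob_measures b"
    and v: "v \<in> sym_prob_measures b" and t: "0 < t" and mix: "\<mu> = mixture t u v"
  shows "u = \<mu>"
proof -
  have \<mu>D: "\<mu> \<in> sym_prob_measures b" and sets: "sets \<mu> = sets borel_pm1"
    and sym: "symmetric_measure \<mu>" and disc: "discrete_at_most 4 \<mu>"
    using \<mu> by (auto simp: sym_discrete_measures_def sym_prob_measures_def)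
  have setsu: "sets u = sets \<mu>" and setsv: "sets v = sets u"
    using u v sets by (auto simp: sym_prob_measures_def)
  obtain T where T: "finite T" "card T \<le> 4" "T \<subseteq> {-1..1}" and symT: "\<And>x. x \<in> T \<Longrightarrow> - x \<in> T"
    and null: "emeasure \<mu> (space \<mu> - T) = 0"
    using discrete_symmetric_support[OF sets sym disc] by metis
  have "space \<mu> - T \<in> sets u"
    using T sets_borel_pm1D(2)[OF sets] unfolding setsu
    by (intro sets.compl_sets) (auto intro!: borel_closed finite_imp_closed)
  then have "ennreal t * emeasure u (space \<mu> - T) = 0"
    using null emeasure_mixture[OF setsv, of "space \<mu> - T" t] mix by simp
  then have "emeasure u (space u - T) = 0"
    using t sets_eq_imp_space_eq[OF setsu] by simp
  with u \<mu>D T symT null show ?thesis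
    by (intro finite_support_measure_determined)
qed

theorem theorem10:
  fixes b :: real
  assumes "0 < b" and "b < 1"
  shows "extreme_measures (sym_prob_measures b) = sym_discrete_measures b"
proof
  show "extreme_measures (sym_prob_measures b) \<subseteq> sym_discrete_measures b"
    using extreme_imp_discrete by blast
  show "sym_discrete_measures b \<subseteq> extreme_measures (sym_prob_measures b)"
  proof
    fix \<mu> assume \<mu>: "\<mu> \<in> sym_discrete_measures b"
    have "u = \<mu> \<and> v = \<mu>"
      if "u \<in> sym_prob_measures b" "v \<in> sym_prob_measures b" "0 < t" "t < 1" "\<mu> = mixture t u v"
      for u v t
    proof
      show "u = \<mu>"
        using mixture_component_eq[OF \<mu>] that by blast
      have "sets u = sets v"
        using that by (simp add: sym_prob_measures_def)
      \<comment> \<open>Exchanging the components makes \<open>v\<close> the first one, with the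
        positive weight \<open>1 - t\<close>.\<close>
      then have "\<mu> = mixture (1 - t) v u"
        using that mixture_commute[of u v t] by simp
      then show "v = \<mu>"
        using mixture_component_eq[OF \<mu>, of v u "1 - t"] that by simp
    qed
    then show "\<mu> \<in> extreme_measures (sym_prob_measures b)"
      using \<mu> by (auto simp: extreme_measures_def sym_discrete_measures_def sym_prob_measures_def)
  qed
qed

end
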